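(* Let $n\ge 7$ with $n\equiv 1\pmod 3$. Then $w_{m-1}=\lceil n(n+1)/3\rceil-1=(n^2+n-2)/3$ and $W_{m-1}=\{\mathbf{z}_2\}$, where $\mathbf{z}_2=\overline{011}[n]$.
   Context: For $\mathbf{x}=(x_0,\ldots,x_{n-1})\in\mathbb{F}_2^n$, the derivative is $\partial\mathbf{x}=(x_0+x_1,\ldots,x_{n-2}+x_{n-1})\in\mathbb{F}_2^{n-1}$, with $\partial^0\mathbf{x}=\mathbf{x}$ and $\partial^i\mathbf{x}=\partial(\partial^{i-1}\mathbf{x})$. The Steinhaus triangle is $T(\mathbf{x})=(\mathbf{x},\partial\mathbf{x},\ldots,\partial^{n-1}\mathbf{x})$; $|\mathbf{y}|$ is the number of ones of a binary sequence and $|T(\mathbf{x})|=\sum_{i=0}^{n-1}|\partial^i\mathbf{x}|$. For fixed $n$, let $0=w_0<w_1<\cdots<w_m$ be the distinct values of $|T(\mathbf{x})|$ over $\mathbf{x}\in\mathbb{F}_2^n$, and $W_i=\{\mathbf{x}\in\mathbb{F}_2^n:|T(\mathbf{x})|=w_i\}$. $\overline{x_1\cdots x_p}[k]$ is the word of the first $k$ letters of the infinite periodic word $x_1\cdots x_px_1\cdots x_p\cdots$. *)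

theory Defs
  imports Complex_Main "HOL-Library.Z2"
begin

text \<open>A vector of \<open>\<bbbF>\<^sub>2\<^sup>n\<close> is a list of length \<open>n\<close> over the two-element field \<^typ>\<open>bit\<close>,
  indexed from \<open>0\<close>.\<close>

definition F2 :: "nat \<Rightarrow> bit list set" where
  "F2 n = {x. length x = n}"

definition deriv :: "bit list \<Rightarrow> bit list" where
  "deriv x = map (\<lambda>j. x ! j + x ! (j + 1)) [0..<length x - 1]"

definition num_ones :: "bit list \<Rightarrow> nat" where
  "num_ones y = length (filter (\<lambda>b. b = 1) y)"

definition steinhaus_triangle :: "bit list \<Rightarrow> bit list list" where
  "steinhaus_triangle x = map (\<lambda>i. (deriv ^^ i) x) [0..<length x]"

definition triangle_weight :: "bit list \<Rightarrow> nat" where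
  "triangle_weight x = (\<Sum>r\<leftarrow>steinhaus_triangle x. num_ones r)"

definition weights :: "nat \<Rightarrow> nat set" where
  "weights n = triangle_weight ` F2 n"

text \<open>The distinct weights \<open>w\<^sub>0 < w\<^sub>1 < \<dots> < w\<^sub>m\<close>, where \<open>m = top_index n\<close>, \<open>w\<^sub>i = nth_weight n i\<close>
  and \<open>W\<^sub>i = weight_class n i\<close>.  Since \<^term>\<open>weights n\<close> is finite and nonempty, \<open>nth_weight n i\<close>
  is meaningful exactly for \<open>i \<le> top_index n\<close>.\<close>

lemma finite_weights: "finite (weights n)"
proof -
  have "b \<in> {0, 1}" for b :: bit by (cases b) auto
  then have "finite (UNIV :: bit set)" by (intro finite_subset[of UNIV "{0, 1}"]) auto
  from finite_lists_length_eq[OF this, of n] show ?thesis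
    by (simp add: weights_def F2_def)
qed

definition top_index :: "nat \<Rightarrow> nat" where
  "top_index n = card (weights n) - 1"

definition nth_weight :: "nat \<Rightarrow> nat \<Rightarrow> nat" where
  "nth_weight n i = sorted_list_of_set (weights n) ! i"

definition weight_class :: "nat \<Rightarrow> nat \<Rightarrow> bit list set" where
  "weight_class n i = {x \<in> F2 n. triangle_weight x = nth_weight n i}"

definition periodic_prefix :: "'a list \<Rightarrow> nat \<Rightarrow> 'a list" where
  "periodic_prefix p k = map (\<lambda>j. p ! (j mod length p)) [0..<k]"

definition z2 :: "nat \<Rightarrow> bit list" where
  "z2 n = periodic_prefix [0, 1, 1] n"

end

theory Submission
  imports Defs
begin

text \<open>
  Removing the first three rows of the triangle of \<open>x\<close> leaves the triangle of \<open>\<partial>\<^sup>3x\<close>.  For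
  \<open>|x| = n \<ge> 2\<close> these rows contain at most \<open>2n - 2\<close> ones, with a deficit that is a sum of local
  penalties over windows of three consecutive letters of \<open>x\<close> and its two ends.  Hence, by induction
  on \<open>n\<close> in steps of three, a triangle whose weight is at most one below the maximum arises from a
  \<open>\<partial>\<^sup>3x\<close> that is a prefix of a \<open>3\<close>-periodic word \<open>011\<close>, \<open>101\<close> or \<open>110\<close>.  Each of these has eight
  preimages under \<open>\<partial>\<^sup>3\<close>, and all but the periodic one have a deficit of at least two within their
  first ten letters.
\<close>

section \<open>Row-by-row recursion for the weight\<close>

lemma bit_exhaust_disj: "(b::bit) = 0 \<or> b = 1"
  by (cases b) auto

lemma deriv_simps [simp]:
  "deriv [] = []"
  "deriv [a] = []"
  "deriv (a # b # xs) = (a + b) # deriv (b # xs)"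
proof -
  show "deriv (a # b # xs) = (a + b) # deriv (b # xs)"
    by (simp add: deriv_def upt_conv_Cons map_Suc_upt[symmetric] del: upt_Suc)
qed (auto simp: deriv_def)

lemma num_ones_simps [simp]:
  "num_ones [] = 0"
  "num_ones (a # xs) = (if a = 1 then 1 else 0) + num_ones xs"
  by (auto simp: num_ones_def)

lemma length_deriv [simp]: "length (deriv x) = length x - 1"
  by (simp add: deriv_def)

lemma triangle_weight_Nil [simp]: "triangle_weight [] = 0"
  by (simp add: triangle_weight_def steinhaus_triangle_def)

lemma triangle_weight_rec:
  assumes "x \<noteq> []"
  shows "triangle_weight x = num_ones x + triangle_weight (deriv x)"
proof -
  obtain n where n: "length x = Suc n"
    using assms by (cases x) auto
  have "steinhaus_triangle x = x # steinhaus_triangle (deriv x)"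
    unfolding steinhaus_triangle_def n length_deriv
    by (simp add: upt_conv_Cons map_Suc_upt[symmetric] funpow_Suc_right
        del: upt_Suc funpow.simps(2))
  then show ?thesis
    by (simp add: triangle_weight_def)
qed

lemma triangle_weight_Cons [simp]:
  "triangle_weight (a # xs) = num_ones (a # xs) + triangle_weight (deriv (a # xs))"
  by (rule triangle_weight_rec) simp

section \<open>The first three rows and their deficit\<close>

definition strip_weight :: "bit list \<Rightarrow> nat" where
  "strip_weight x = num_ones x + num_ones (deriv x) + num_ones (deriv (deriv x))"

lemma triangle_weight_strip:
  "length x \<ge> 3 \<Longrightarrow>
    triangle_weight x = strip_weight x + triangle_weight (deriv (deriv (deriv x)))"
  by (simp add: strip_weight_def triangle_weight_rec flip: length_greater_0_conv)

text \<open>Putting \<open>a\<close> before \<open>b # c # xs\<close> adds [a = 1] + [a \<noteq> b]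
  + [a \<noteq> c] ones to the three rows. A window costs 2 minus this number, plus [b = c = 0],
  minus [a = b = 0]; the correction absorbs the surplus of 100, which adds three ones.\<close>

fun penalty :: "bit list \<Rightarrow> nat" where
  "penalty (a # b # c # xs) =
     (if a = c then if b = 1 then 1 else if a = 0 then 2 else 0 else 0) + penalty (b # c # xs)"
| "penalty [a, b] = (if a = 0 \<and> b = 0 then 1 else 0)"
| "penalty _ = 0"

definition deficit :: "bit list \<Rightarrow> nat" where
  "deficit x = (if take 2 x = [0, 0] then 1 else 0) + penalty x"

text \<open>The boundary term \<open>[x\<^sub>0 = x\<^sub>1 = 0]\<close> is the potential that makes the penalties nonnegative.\<close>

lemma strip_weight_plus_deficit:
  "strip_weight (a # b # xs) + deficit (a # b # xs) = 2 * length xs + 2"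
proof (induction xs arbitrary: a b)
  case Nil
  show ?case
    using bit_exhaust_disj[of a] bit_exhaust_disj[of b]
    by (auto simp: strip_weight_def deficit_def)
next
  case (Cons c xs)
  show ?case
    using bit_exhaust_disj[of a] bit_exhaust_disj[of b] bit_exhaust_disj[of c] Cons.IH[of b c]
    by (auto simp: strip_weight_def deficit_def)
qed

lemma triangle_weight_deficit:
  assumes "length x \<ge> 3"
  shows "triangle_weight x + deficit x
    = triangle_weight (deriv (deriv (deriv x))) + 2 * (length x - 1)"
proof -
  obtain a b xs where "x = a # b # xs"
    using assms by (auto simp: numeral_3_eq_3 Suc_le_length_iff)
  with triangle_weight_strip[OF assms] strip_weight_plus_deficit[of a b xs]
  show ?thesis by simp
qed

section \<open>Inverting the third derivative\<close>

text \<open>The binomial coefficients 1, 3, 3, 1 are odd, so a letter \<open>d\<close> of the third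
  derivative is the sum of four consecutive letters. The first three being \<open>a\<close>,
  \<open>b\<close>, \<open>c\<close>, the fourth must be \<open>a + b + c + d\<close>.\<close>

fun lift3 :: "bit \<Rightarrow> bit \<Rightarrow> bit \<Rightarrow> bit list \<Rightarrow> bit list" where
  "lift3 a b c [] = [a, b, c]"
| "lift3 a b c (d # y) = a # lift3 b c (a + b + c + d) y"

lemma lift3_deriv3: "lift3 a b c (deriv (deriv (deriv (a # b # c # xs)))) = a # b # c # xs"
proof (induction xs arbitrary: a b c)
  case Nil
  show ?case by simp
next
  case (Cons d xs)
  have "a + b + c + (a + b + (b + c) + (b + c + (c + d))) = d"
    using bit_exhaust_disj[of a] bit_exhaust_disj[of b] bit_exhaust_disj[of c]
      bit_exhaust_disj[of d] by auto
  with Cons.IH[of b c d] show ?case by simp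
qed

lemma lift3_Cons_Cons: "\<exists>ys. lift3 a b c y = a # b # c # ys"
proof (induction y arbitrary: a b c)
  case (Cons d y)
  from Cons.IH[of b c "a + b + c + d"] show ?case by auto
qed simp

lemma deriv3_lift3: "deriv (deriv (deriv (lift3 a b c y))) = y"
proof (induction y arbitrary: a b c)
  case Nil
  show ?case by simp
next
  case (Cons d y)
  define e where "e = a + b + c + d"
  obtain ys where ys: "lift3 b c e y = b # c # e # ys"
    using lift3_Cons_Cons by blast
  have d: "a + b + (b + c) + (b + c + (c + e)) = d"
    using bit_exhaust_disj[of a] bit_exhaust_disj[of b] bit_exhaust_disj[of c]
      bit_exhaust_disj[of d] by (auto simp: e_def)
  have "lift3 a b c (d # y) = a # b # c # e # ys"
    unfolding lift3.simps e_def[symmetric] ys ..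
  moreover have "deriv (deriv (deriv (b # c # e # ys))) = y"
    using Cons.IH[of b c e] by (simp only: ys)
  ultimately show ?case
    by (simp only: deriv_simps d)
qed

section \<open>Words of period three with two ones\<close>

lemma periodic_prefix_add_length:
  "periodic_prefix p (length p + n) = p @ periodic_prefix p n"
proof (rule nth_equalityI)
  fix i assume "i < length (periodic_prefix p (length p + n))"
  then show "periodic_prefix p (length p + n) ! i = (p @ periodic_prefix p n) ! i"
    by (auto simp: periodic_prefix_def nth_append le_mod_geq)
qed (simp add: periodic_prefix_def)

lemma length_periodic_prefix [simp]: "length (periodic_prefix p n) = n"
  by (simp add: periodic_prefix_def)

lemma periodic_prefix_3:
  "periodic_prefix [p, q, r] (n + 3) = p # q # r # periodic_prefix [p, q, r] n"
  using periodic_prefix_add_length[of "[p, q, r]" n]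
  by (simp add: add.commute numeral_3_eq_3)

lemma periodic_prefix_1: "periodic_prefix (p # ps) (Suc 0) = [p]"
  by (simp add: periodic_prefix_def)

abbreviation two_ones :: "bit \<Rightarrow> bit \<Rightarrow> bit \<Rightarrow> bool" where
  "two_ones p q r \<equiv> (p, q, r) \<in> {(0, 1, 1), (1, 0, 1), (1, 1, 0)}"

text \<open>Since \<open>p + q + r = 0\<close>, every new letter equals the letter just read, which
  is the one three places earlier.\<close>

lemma lift3_periodic:
  assumes "two_ones p q r"
  shows "lift3 p q r (periodic_prefix [p, q, r] (3 * k + 1)) = periodic_prefix [p, q, r] (3 * k + 4)"
proof (induction k)
  case 0
  then show ?case
    using assms periodic_prefix_3[of p q r 1] by (auto simp: periodic_prefix_1)
next
  case (Suc k)
  then show ?case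
    using assms periodic_prefix_3[of p q r "3 * k + 1"] periodic_prefix_3[of p q r "3 * k + 4"]
    by (auto simp: algebra_simps)
qed

text \<open>The only windows are 011, 110 and 101, all free of penalty, and neither end is
  00.\<close>

lemma deficit_periodic:
  assumes "two_ones p q r"
  shows "deficit (periodic_prefix [p, q, r] (3 * k + 4)) = 0"
proof (induction k)
  case 0
  then show ?case
    using assms periodic_prefix_3[of p q r 1]
    by (auto simp: periodic_prefix_1 deficit_def)
next
  case (Suc k)
  then show ?case
    using assms periodic_prefix_3[of p q r "3 * k + 1"] periodic_prefix_3[of p q r "3 * k + 4"]
    by (auto simp: deficit_def algebra_simps)
qed

lemma deficit_lift3_ge_2:
  assumes "two_ones p q r" "(a, b, c) \<noteq> (p, q, r)"
  shows "deficit (lift3 a b c (p # q # r # p # q # r # p # ys)) \<ge> 2"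
proof -
  \<comment> \<open>Seven lifting steps and \<open>prefix\<close> make ten letters explicit; the
    penalties of later windows can only add to the deficit.\<close>
  have prefix: "\<exists>zs. lift3 a b c ys = a # b # c # zs" for a b c ys
    by (rule lift3_Cons_Cons)
  show ?thesis
    using assms bit_exhaust_disj[of a] bit_exhaust_disj[of b] bit_exhaust_disj[of c]
      prefix[of 0 0 0 ys] prefix[of 0 0 1 ys] prefix[of 0 1 0 ys] prefix[of 0 1 1 ys]
      prefix[of 1 0 0 ys] prefix[of 1 0 1 ys] prefix[of 1 1 0 ys] prefix[of 1 1 1 ys]
    by (elim disjE exE) (auto simp: deficit_def)
qed

lemma deriv3_periodic_cases:
  assumes "two_ones p q r" "length x = 3 * k + 10"
    and "deriv (deriv (deriv x)) = periodic_prefix [p, q, r] (3 * k + 7)"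
  shows "x = periodic_prefix [p, q, r] (3 * k + 10) \<or> deficit x \<ge> 2"
proof -
  have "3 \<le> length x"
    using assms(2) by simp
  then obtain a b c xs where x: "x = a # b # c # xs"
    by (auto simp: numeral_3_eq_3 Suc_le_length_iff)
  have eq: "x = lift3 a b c (periodic_prefix [p, q, r] (3 * k + 7))"
    using lift3_deriv3[of a b c xs] assms(3) x by simp
  show ?thesis
  proof (cases "(a, b, c) = (p, q, r)")
    case True
    with eq lift3_periodic[OF assms(1), of "k + 2"] show ?thesis
      by (simp add: algebra_simps)
  next
    case False
    have "\<exists>ys. periodic_prefix [p, q, r] (3 * k + 7) = p # q # r # p # q # r # p # ys"
    proof (cases k)
      case 0
      then show ?thesis
        using periodic_prefix_3[of p q r 4] periodic_prefix_3[of p q r 1]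
        by (simp add: periodic_prefix_1)
    next
      case (Suc m)
      then show ?thesis
        using periodic_prefix_3[of p q r "3 * m + 7"] periodic_prefix_3[of p q r "3 * m + 4"]
          periodic_prefix_3[of p q r "3 * m + 1"]
        by (simp add: algebra_simps)
    qed
    with False eq deficit_lift3_ge_2[OF assms(1)] show ?thesis
      by metis
  qed
qed

text \<open>With zero deficit the strips contribute 6 + 12 + ... + 6k. The single letter left at the
  bottom is \<open>p\<close>, which is why 011 falls one short of the other two words.\<close>

lemma triangle_weight_periodic:
  assumes "two_ones p q r"
  shows "triangle_weight (periodic_prefix [p, q, r] (3 * k + 1)) =
    3 * k * k + 3 * k + (if p = 1 then 1 else 0)"
proof (induction k)
  case 0
  then show ?case by (simp add: periodic_prefix_1)
next
  case (Suc k)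
  let ?x = "periodic_prefix [p, q, r] (3 * k + 4)"
  have "deriv (deriv (deriv ?x)) = periodic_prefix [p, q, r] (3 * k + 1)"
    using deriv3_lift3 by (metis lift3_periodic[OF assms])
  then have "triangle_weight ?x =
      triangle_weight (periodic_prefix [p, q, r] (3 * k + 1)) + 2 * (3 * k + 3)"
    using triangle_weight_deficit[of ?x] deficit_periodic[OF assms] by simp
  with Suc show ?case by (simp add: algebra_simps)
qed

section \<open>The two largest weights\<close>

text \<open>A check of 128 words. The induction cannot start at length 4, where 0111 shares the
  weight 6 with 0110.\<close>

lemma triangle_weight_length_7:
  assumes "length x = 7"
  shows "triangle_weight x \<le> 19 \<and>
    (triangle_weight x = 19 \<longrightarrow> x \<in> {[1,0,1,1,0,1,1], [1,1,0,1,1,0,1]}) \<and>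
    (triangle_weight x = 18 \<longrightarrow> x = [0,1,1,0,1,1,0])"
proof -
  obtain a b c d e f g where x: "x = [a, b, c, d, e, f, g]"
    using assms by (auto simp: eval_nat_numeral length_Suc_conv)
  show ?thesis
    unfolding x
    using bit_exhaust_disj[of a] bit_exhaust_disj[of b] bit_exhaust_disj[of c]
      bit_exhaust_disj[of d] bit_exhaust_disj[of e] bit_exhaust_disj[of f] bit_exhaust_disj[of g]
    by (elim disjE) simp_all
qed

text \<open>For n = 3k + 7 the bound is n(n+1)/3 rounded up. Both top weights are treated together
  because a word one below the maximum could a priori have a third derivative of either
  weight.\<close>

lemma triangle_weight_top:
  assumes "length x = 3 * k + 7"
  shows "triangle_weight x \<le> 3 * k * k + 15 * k + 19 \<and>
    (triangle_weight x = 3 * k * k + 15 * k + 19 \<longrightarrow>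
       x \<in> {periodic_prefix [1, 0, 1] (3 * k + 7), periodic_prefix [1, 1, 0] (3 * k + 7)}) \<and>
    (triangle_weight x = 3 * k * k + 15 * k + 18 \<longrightarrow> x = periodic_prefix [0, 1, 1] (3 * k + 7))"
  using assms
proof (induction k arbitrary: x)
  case 0
  have "periodic_prefix [p, q, r] 7 = [p, q, r, p, q, r, p]" for p q r :: bit
    using periodic_prefix_3[of p q r 4] periodic_prefix_3[of p q r 1]
    by (simp add: periodic_prefix_1)
  with triangle_weight_length_7[of x] 0 show ?case by simp
next
  case (Suc k)
  let ?y = "deriv (deriv (deriv x))"
  let ?M = "3 * k * k + 15 * k + 19"
  have len: "length x = 3 * k + 10" "length ?y = 3 * k + 7"
    using Suc.prems by auto
  have M: "3 * Suc k * Suc k + 15 * Suc k + 19 = ?M + 6 * k + 18"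
    "3 * Suc k * Suc k + 15 * Suc k + 18 = ?M + 6 * k + 17" "3 * Suc k + 7 = 3 * k + 10"
    by (simp_all add: algebra_simps)
  have eq: "triangle_weight x + deficit x = triangle_weight ?y + 6 * k + 18"
    using triangle_weight_deficit[of x] len by simp
  note IH = Suc.IH[OF len(2)]
  \<comment> \<open>A deficit below 2 forces periodicity, and the exact weight then tells which top
    value is attained.\<close>
  have periodic: "x = periodic_prefix [p, q, r] (3 * k + 10)"
    and weight: "triangle_weight x = ?M + 6 * k + (if p = 1 then 18 else 17)"
    if "two_ones p q r" "?y = periodic_prefix [p, q, r] (3 * k + 7)" "deficit x < 2" for p q r
  proof -
    show x: "x = periodic_prefix [p, q, r] (3 * k + 10)"
      using deriv3_periodic_cases[OF that(1) len(1) that(2)] that(3) by simp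
    show "triangle_weight x = ?M + 6 * k + (if p = 1 then 18 else 17)"
      using triangle_weight_periodic[OF that(1), of "k + 3"] x by (simp add: algebra_simps)
  qed
  \<comment> \<open>In the last case, and in the others when the deficit is at least 2, the weight
    of \<open>x\<close> is at most \<open>?M + 6 * k + 16\<close>, below both top values.\<close>
  consider "?y = periodic_prefix [1, 0, 1] (3 * k + 7)"
    | "?y = periodic_prefix [1, 1, 0] (3 * k + 7)"
    | "?y = periodic_prefix [0, 1, 1] (3 * k + 7)"
    | "triangle_weight ?y < ?M - 1"
    using IH by fastforce
  then have "triangle_weight x \<le> ?M + 6 * k + 18 \<and>
    (triangle_weight x = ?M + 6 * k + 18 \<longrightarrow>
       x \<in> {periodic_prefix [1, 0, 1] (3 * k + 10), periodic_prefix [1, 1, 0] (3 * k + 10)}) \<and>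
    (triangle_weight x = ?M + 6 * k + 17 \<longrightarrow> x = periodic_prefix [0, 1, 1] (3 * k + 10))"
  proof cases
    case 1
    show ?thesis
    proof (cases "deficit x < 2")
      case True
      with 1 periodic[of 1 0 1] weight[of 1 0 1] show ?thesis by simp
    next
      case False
      with eq IH show ?thesis by linarith
    qed
  next
    case 2
    show ?thesis
    proof (cases "deficit x < 2")
      case True
      with 2 periodic[of 1 1 0] weight[of 1 1 0] show ?thesis by simp
    next
      case False
      with eq IH show ?thesis by linarith
    qed
  next
    case 3
    show ?thesis
    proof (cases "deficit x < 2")
      case True
      with 3 periodic[of 0 1 1] weight[of 0 1 1] show ?thesis by simp
    next
      case False
      with eq IH show ?thesis by linarith
    qed
  next
    case 4
    with eq show ?thesis by linarith
  qed
  then show ?case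
    unfolding M .
qed

section \<open>Position of the second largest weight\<close>

text \<open>Weights are ranked from the smallest up; splitting off the top two locates
  \<open>m\<close> without enumerating the smaller ones.\<close>

lemma sorted_list_of_set_top_two:
  fixes A :: "nat set"
  assumes "finite A" "Suc m \<in> A" "m \<in> A" "\<And>a. a \<in> A \<Longrightarrow> a \<le> Suc m"
  shows "sorted_list_of_set A = sorted_list_of_set (A - {m, Suc m}) @ [m, Suc m]"
proof (rule sorted_distinct_set_unique)
  have "a \<le> m" if "a \<in> A - {m, Suc m}" for a
    using assms(4)[of a] that by auto
  then show "sorted (sorted_list_of_set (A - {m, Suc m}) @ [m, Suc m])"
    using assms by (auto simp: sorted_append intro: le_SucI)
qed (use assms in auto)

theorem theorem8p1:
  fixes n :: nat
  assumes "n \<ge> 7" and "n mod 3 = 1"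
  shows "top_index n \<ge> 1
    \<and> int (nth_weight n (top_index n - 1)) = \<lceil>real n * (real n + 1) / 3\<rceil> - 1
    \<and> real (nth_weight n (top_index n - 1)) = ((real n)^2 + real n - 2) / 3
    \<and> weight_class n (top_index n - 1) = {z2 n}"
proof -
  obtain k where n: "n = 3 * k + 7"
  proof
    show "n = 3 * ((n - 7) div 3) + 7" using assms by presburger
  qed
  define m where "m = 3 * k * k + 15 * k + 18"
  have weight: "triangle_weight (periodic_prefix [p, q, r] n) = m + (if p = 1 then 1 else 0)"
    if "two_ones p q r" for p q r
    using triangle_weight_periodic[OF that, of "k + 2"] by (simp add: n m_def algebra_simps)
  have top: "triangle_weight x \<le> Suc m" "triangle_weight x = m \<Longrightarrow> x = z2 n" if "x \<in> F2 n" for x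
    using triangle_weight_top[of x k] that by (auto simp: F2_def n m_def z2_def)
  have mem: "periodic_prefix [p, q, r] n \<in> F2 n" for p q r
    by (simp add: F2_def)
  have in_weights: "m \<in> weights n" "Suc m \<in> weights n"
    unfolding weights_def
    using weight[of 0 1 1] weight[of 1 0 1]
    by (auto intro: rev_image_eqI[OF mem[of 0 1 1]] rev_image_eqI[OF mem[of 1 0 1]])
  let ?l = "sorted_list_of_set (weights n - {m, Suc m})"
  have sorted: "sorted_list_of_set (weights n) = ?l @ [m, Suc m]"
  proof (rule sorted_list_of_set_top_two[OF finite_weights in_weights(2,1)])
    show "a \<le> Suc m" if "a \<in> weights n" for a
      using that top(1) by (auto simp: weights_def)
  qed
  have "card (weights n) = length ?l + 2"
    using arg_cong[OF sorted, of length] by simp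
  then have idx: "top_index n = length ?l + 1"
    by (simp add: top_index_def)
  \<comment> \<open>The index \<open>top_index n - 1\<close> is \<open>length ?l\<close>, the place
    of \<open>m\<close> just after \<open>?l\<close>.\<close>
  then have nth: "nth_weight n (top_index n - 1) = m"
    by (simp add: nth_weight_def sorted nth_append)
  have "weight_class n (top_index n - 1) = {z2 n}"
    unfolding weight_class_def nth
    using top(2) weight[of 0 1 1] mem by (auto simp: z2_def)
  moreover have "real m = ((real n)^2 + real n - 2) / 3"
    by (simp add: m_def n power2_eq_square algebra_simps)
  \<comment> \<open>Here n(n+1)/3 = m + 2/3.\<close>
  moreover have "\<lceil>real n * (real n + 1) / 3\<rceil> = int m + 1"
    by (rule ceiling_unique) (simp_all add: m_def n field_simps)
  ultimately show ?thesis
    using idx nth by simp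
qed

end
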